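(* Let $n\ge 1$ be an integer and let $A,B\in M_n(\mathbb{R})$. The dual matrix $\mathcal{M}=A+B\epsilon\in M_n(\mathbb{D})$ is (von Neumann) regular in $M_n(\mathbb{D})$ if and only if $A$ is regular in $M_n(\mathbb{R})$ and $(I-AA^{-})B(I-A^{-}A)=0$ for some inner inverse $A^{-}\in M_n(\mathbb{R})$ of $A$.
   Context: $\mathbb{D}=\{a+b\epsilon \mid a,b\in\mathbb{R},\ \epsilon^2=0\}$ is the ring of dual numbers. $M_n(\mathbb{D})$ is the ring of $n\times n$ matrices over $\mathbb{D}$; each element is uniquely of the form $A+B\epsilon$ with $A,B\in M_n(\mathbb{R})$. An element $a$ of a ring $R$ (associative with identity) is (von Neumann) regular if there is $x\in R$ with $a=axa$; any such $x$ is called an inner inverse of $a$. $I$ is the $n\times n$ identity matrix. *)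

theory Defs
  imports "HOL-Analysis.Analysis"
begin

datatype dual = Dual (re_part: real) (eps_part: real)

instantiation dual :: comm_ring_1
begin

definition zero_dual :: dual where "0 = Dual 0 0"
definition one_dual :: dual where "1 = Dual 1 0"
definition plus_dual :: "dual \<Rightarrow> dual \<Rightarrow> dual" where
  "x + y = Dual (re_part x + re_part y) (eps_part x + eps_part y)"
definition uminus_dual :: "dual \<Rightarrow> dual" where
  "- x = Dual (- re_part x) (- eps_part x)"
definition minus_dual :: "dual \<Rightarrow> dual \<Rightarrow> dual" where
  "x - y = Dual (re_part x - re_part y) (eps_part x - eps_part y)"
definition times_dual :: "dual \<Rightarrow> dual \<Rightarrow> dual" where
  "x * y = Dual (re_part x * re_part y) (re_part x * eps_part y + eps_part x * re_part y)"

instance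
  by standard
    (auto simp: zero_dual_def one_dual_def plus_dual_def uminus_dual_def minus_dual_def
      times_dual_def algebra_simps)

end

definition dual_of_real :: "real \<Rightarrow> dual" where
  "dual_of_real a = Dual a 0"

definition dual_eps :: dual ("\<epsilon>") where
  "\<epsilon> = Dual 0 1"

lemma dual_eps_square: "\<epsilon> * \<epsilon> = 0"
  by (simp add: dual_eps_def times_dual_def zero_dual_def)

lemma Dual_eq: "Dual a b = dual_of_real a + dual_of_real b * \<epsilon>"
  by (simp add: dual_of_real_def dual_eps_def plus_dual_def times_dual_def)

definition dual_matrix :: "real^'n^'n \<Rightarrow> real^'n^'n \<Rightarrow> dual^'n^'n" where
  "dual_matrix A B = map_matrix dual_of_real A + map_matrix (\<lambda>b. dual_of_real b * \<epsilon>) B"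

lemma dual_matrix_ex1:
  fixes M :: "dual^'n^'n"
  shows "\<exists>!(A, B). M = dual_matrix A B"
proof -
  have nth: "dual_matrix A B $ i $ j = Dual (A $ i $ j) (B $ i $ j)" for A B :: "real^'n^'n" and i j
    by (simp add: dual_matrix_def Dual_eq)
  have eq: "M = dual_matrix A B \<longleftrightarrow> A = map_matrix re_part M \<and> B = map_matrix eps_part M" for A B
    by (auto simp: vec_eq_iff nth dual.expand)
  show ?thesis
    by (auto simp: eq)
qed

(* The ring M_n(R) has product **; the type class product * on vectors is componentwise,
   so regularity is stated with ** rather than over a type class of rings. *)

definition inner_inverse :: "'a::ring_1^'n^'n \<Rightarrow> 'a^'n^'n \<Rightarrow> bool" where
  "inner_inverse A X \<longleftrightarrow> A = A ** X ** A"

definition regular_matrix :: "'a::ring_1^'n^'n \<Rightarrow> bool" where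
  "regular_matrix A \<longleftrightarrow> (\<exists>X. inner_inverse A X)"

end

theory Submission
  imports Defs
begin

text \<open>Comparing coefficients of 1 and \<epsilon>
  (\<open>inner_inverse_dual_matrix_iff\<close>) turns regularity of A + B\<epsilon> into the
  existence of an inner inverse X of A and a matrix Y with B = AXB + (AY + BX)A. Every term on the
  right begins or ends with A, and I - AX and I - XA annihilate A from the left and from the right,
  so sandwiching B between them gives 0. Conversely, if the sandwich vanishes, expanding it
  (\<open>matrix_compl_expand\<close>) gives exactly this equation for Y = -XBX.\<close>

lemma dual_matrix_nth [simp]: "dual_matrix A B $ i $ j = Dual (A $ i $ j) (B $ i $ j)"
  by (simp add: dual_matrix_def Dual_eq)

lemma dual_matrix_eq_iff: "dual_matrix A B = dual_matrix C D \<longleftrightarrow> A = C \<and> B = D"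
  by (auto simp: vec_eq_iff)

lemma dual_matrix_cases: obtains A B where "M = dual_matrix A B"
  using dual_matrix_ex1[of M] by auto

lemma sum_Dual: "(\<Sum>i\<in>S. Dual (f i) (g i)) = Dual (sum f S) (sum g S)"
  by (induction S rule: infinite_finite_induct) (auto simp: zero_dual_def plus_dual_def)

text \<open>The term in \<open>B ** D\<close> disappears because \<epsilon> squares to 0.\<close>

lemma dual_matrix_mult:
  "dual_matrix A B ** dual_matrix C D = dual_matrix (A ** C) (A ** D + B ** C)"
  by (simp add: vec_eq_iff matrix_matrix_mult_def times_dual_def sum_Dual sum.distrib)

lemma inner_inverse_dual_matrix_iff:
  "inner_inverse (dual_matrix A B) (dual_matrix X Y) \<longleftrightarrow>
    inner_inverse A X \<and> B = A ** X ** B + (A ** Y + B ** X) ** A"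
  by (simp add: inner_inverse_def dual_matrix_mult dual_matrix_eq_iff)

lemma matrix_add_rdistrib:
  fixes A :: "'a::semiring_1^'n^'m"
  shows "(A + B) ** C = A ** C + B ** C"
  by (simp add: vec_eq_iff matrix_matrix_mult_def distrib_right sum.distrib)

lemma matrix_sub_ldistrib:
  fixes A :: "'a::ring_1^'n^'m"
  shows "A ** (B - C) = A ** B - A ** C"
  by (simp add: vec_eq_iff matrix_matrix_mult_def right_diff_distrib sum_subtractf)

lemma matrix_sub_rdistrib:
  fixes A :: "'a::ring_1^'n^'m"
  shows "(A - B) ** C = A ** C - B ** C"
  by (simp add: vec_eq_iff matrix_matrix_mult_def left_diff_distrib sum_subtractf)

text \<open>Setting this expression to 0 expresses B through terms with a factor A at one end, the
  form required of the \<epsilon>-part.\<close>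

lemma matrix_compl_expand:
  fixes A B X :: "'a::ring_1^'n^'n"
  shows "(mat 1 - A ** X) ** B ** (mat 1 - X ** A) =
    B - A ** X ** B - B ** X ** A + A ** X ** B ** X ** A"
  by (simp add: matrix_sub_ldistrib matrix_sub_rdistrib matrix_mul_assoc)

theorem proposition3p1:
  fixes A B :: "real^'n^'n"
  shows "regular_matrix (dual_matrix A B) \<longleftrightarrow>
    regular_matrix A \<and>
    (\<exists>X. inner_inverse A X \<and> (mat 1 - A ** X) ** B ** (mat 1 - X ** A) = 0)"
proof
  assume "regular_matrix (dual_matrix A B)"
  then obtain X Y where inv: "inner_inverse (dual_matrix A B) (dual_matrix X Y)"
    unfolding regular_matrix_def by (metis dual_matrix_cases)
  then have A: "inner_inverse A X" and B: "B = A ** X ** B + (A ** Y + B ** X) ** A"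
    by (simp_all add: inner_inverse_dual_matrix_iff)
  have left: "(mat 1 - A ** X) ** A = 0" and right: "A ** (mat 1 - X ** A) = 0"
    using A by (simp_all add: inner_inverse_def matrix_sub_ldistrib matrix_sub_rdistrib matrix_mul_assoc)
  have "(mat 1 - A ** X) ** B ** (mat 1 - X ** A) =
      (mat 1 - A ** X) ** (A ** X ** B + (A ** Y + B ** X) ** A) ** (mat 1 - X ** A)"
    using B by presburger
  \<comment> \<open>Regrouped so that each summand contains a product covered by \<open>left\<close>
    or \<open>right\<close>.\<close>
  also have "\<dots> =
      (mat 1 - A ** X) ** A ** (X ** B ** (mat 1 - X ** A)) +
      (mat 1 - A ** X) ** (A ** Y + B ** X) ** (A ** (mat 1 - X ** A))"
    by (simp only: matrix_add_ldistrib matrix_add_rdistrib matrix_mul_assoc)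
  also have "\<dots> = 0"
    by (simp add: left right)
  finally show "regular_matrix A \<and>
      (\<exists>X. inner_inverse A X \<and> (mat 1 - A ** X) ** B ** (mat 1 - X ** A) = 0)"
    using A by (auto simp: regular_matrix_def)
next
  assume "regular_matrix A \<and>
    (\<exists>X. inner_inverse A X \<and> (mat 1 - A ** X) ** B ** (mat 1 - X ** A) = 0)"
  then obtain X where A: "inner_inverse A X"
    and "(mat 1 - A ** X) ** B ** (mat 1 - X ** A) = 0"
    by blast
  then have B: "B = A ** X ** B + B ** X ** A - A ** X ** B ** X ** A"
    by (simp add: matrix_compl_expand algebra_simps)
  \<comment> \<open>The witness Y = -XBX is chosen so that AYA supplies the term -AXBXA in
    \<open>B\<close>. Writing it as a difference from 0 lets \<open>matrix_sub_ldistrib\<close>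
    apply.\<close>
  have "A ** (0 - X ** B ** X) = 0 - A ** X ** B ** X"
    by (simp only: matrix_sub_ldistrib matrix_mul_assoc) simp
  then have "A ** X ** B + (A ** (0 - X ** B ** X) + B ** X) ** A =
      A ** X ** B + B ** X ** A - A ** X ** B ** X ** A"
    by (simp add: matrix_sub_rdistrib)
  then have "inner_inverse (dual_matrix A B) (dual_matrix X (0 - X ** B ** X))"
    unfolding inner_inverse_dual_matrix_iff using A B by presburger
  then show "regular_matrix (dual_matrix A B)"
    unfolding regular_matrix_def by blast
qed

end
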